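(* Let $k\in\mathbb{N}$, let $\phi,\psi,\eta,\xi,a,b>0$ be real numbers and let $P,Q,R,S\in\mathscr{M}_k$. Then $$\mathfrak{BL}_{(\phi,\psi)}^{(R,S,\eta,\xi)}(a,b;P,Q)=\sum_{n,r=0}^{\infty}\frac{\mathfrak{B}_{(\phi,\psi)}^{(R,S,\eta,\xi)}(P+nI,Q+rI)}{n!\,r!}\,(\log a)^{r}(\log b)^{n}.$$
   Context: $\mathscr{M}_k$ is the set of $k\times k$ complex Hermitian matrices that are positive stable (all eigenvalues have positive real part). $I$ is the $k\times k$ identity matrix. For $x>0$ and a square matrix $A$, $x^{A}=\exp(A\ln x)$. The two-parameter Mittag-Leffler matrix function is $\mathcal{E}_{(\phi,\psi)}(A)=\sum_{n=0}^{\infty}\frac{A^n}{\Gamma(\phi n+\psi)}$ for $\phi,\psi>0$. For real $\phi,\psi,\eta,\xi,a,b>0$ and $P,Q,R,S\in\mathscr{M}_k$ the generalized beta matrix function is $$\mathfrak{B}_{(\phi,\psi)}^{(R,S,\eta,\xi)}(P,Q)=\int_{0}^{1}x^{P-I}(1-x)^{Q-I}\mathcal{E}_{(\phi,\psi)}\left(-\frac{R}{x^{\eta}}\right)\mathcal{E}_{(\phi,\psi)}\left(-\frac{S}{(1-x)^{\xi}}\right)dx,$$ and the generalized beta-logarithmic matrix function is $$\mathfrak{BL}_{(\phi,\psi)}^{(R,S,\eta,\xi)}(a,b;P,Q)=\int_{0}^{1}a^{1-x}b^{x}x^{P-I}(1-x)^{Q-I}\mathcal{E}_{(\phi,\psi)}\left(-\frac{R}{x^{\eta}}\right)\mathcal{E}_{(\phi,\psi)}\left(-\frac{S}{(1-x)^{\xi}}\right)dx,$$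 with matrix products taken in the written order. Here $\log$ is the natural logarithm and $0^0=1$.
   Formalization: The integral defining the left-hand side is assumed to converge (possibly conditionally); it does not for all φ>0, e.g. it diverges for k=1, φ=4, ψ=η=ξ=a=b=P=Q=R=S=1, where the left-hand side is undefined. *)

theory Defs
  imports "HOL-Analysis.Analysis"
begin

text \<open>
  Square complex matrices are elements of \<^typ>\<open>complex^'k^'k\<close>. The class operations \<open>*\<close> and
  \<open>^\<close> act entrywise on this type, so powers and power series are set up here for the matrix
  product \<open>**\<close>.
\<close>

definition conj_transpose :: "complex^'k^'k \<Rightarrow> complex^'k^'k" where
  "conj_transpose A = (\<chi> i j. cnj (A $ j $ i))"

definition hermitian :: "complex^'k^'k \<Rightarrow> bool" where
  "hermitian A \<longleftrightarrow> conj_transpose A = A"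

definition is_eigenvalue :: "complex^'k^'k \<Rightarrow> complex \<Rightarrow> bool" where
  "is_eigenvalue A c \<longleftrightarrow> (\<exists>v. v \<noteq> 0 \<and> A *v v = c *s v)"

definition positive_stable :: "complex^'k^'k \<Rightarrow> bool" where
  "positive_stable A \<longleftrightarrow> (\<forall>c. is_eigenvalue A c \<longrightarrow> Re c > 0)"

definition hermitian_pos_stable :: "(complex^'k^'k) set" where
  "hermitian_pos_stable = {A. hermitian A \<and> positive_stable A}"

primrec mat_pow :: "complex^'k^'k \<Rightarrow> nat \<Rightarrow> complex^'k^'k" where
  "mat_pow A 0 = mat 1"
| "mat_pow A (Suc n) = A ** mat_pow A n"

definition mat_exp :: "complex^'k^'k \<Rightarrow> complex^'k^'k" where
  "mat_exp A = (\<Sum>n. (1 / fact n) *\<^sub>R mat_pow A n)"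

definition real_powr_mat :: "real \<Rightarrow> complex^'k^'k \<Rightarrow> complex^'k^'k" where
  "real_powr_mat x A = mat_exp (ln x *\<^sub>R A)"

definition mittag_leffler :: "real \<Rightarrow> real \<Rightarrow> complex^'k^'k \<Rightarrow> complex^'k^'k" where
  "mittag_leffler \<phi> \<psi> A = (\<Sum>n. (1 / Gamma (\<phi> * real n + \<psi>)) *\<^sub>R mat_pow A n)"

definition beta_integrand ::
  "real \<Rightarrow> real \<Rightarrow> complex^'k^'k \<Rightarrow> complex^'k^'k \<Rightarrow> real \<Rightarrow> real \<Rightarrow>
   complex^'k^'k \<Rightarrow> complex^'k^'k \<Rightarrow> real \<Rightarrow> complex^'k^'k" where
  "beta_integrand \<phi> \<psi> R S \<eta> \<xi> P Q x =
     real_powr_mat x (P - mat 1) ** real_powr_mat (1 - x) (Q - mat 1)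
       ** mittag_leffler \<phi> \<psi> (- ((1 / x powr \<eta>) *\<^sub>R R))
       ** mittag_leffler \<phi> \<psi> (- ((1 / (1 - x) powr \<xi>) *\<^sub>R S))"

definition beta_log_integrand ::
  "real \<Rightarrow> real \<Rightarrow> complex^'k^'k \<Rightarrow> complex^'k^'k \<Rightarrow> real \<Rightarrow> real \<Rightarrow>
   real \<Rightarrow> real \<Rightarrow> complex^'k^'k \<Rightarrow> complex^'k^'k \<Rightarrow> real \<Rightarrow> complex^'k^'k" where
  "beta_log_integrand \<phi> \<psi> R S \<eta> \<xi> a b P Q x =
     (a powr (1 - x) * b powr x) *\<^sub>R
       (real_powr_mat x (P - mat 1) ** real_powr_mat (1 - x) (Q - mat 1)
         ** mittag_leffler \<phi> \<psi> (- ((1 / x powr \<eta>) *\<^sub>R R))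
         ** mittag_leffler \<phi> \<psi> (- ((1 / (1 - x) powr \<xi>) *\<^sub>R S)))"

text \<open>
  The two integrals below are gauge (Henstock-Kurzweil) integrals, which cover absolutely convergent
  as well as conditionally convergent improper integrals. The values carry meaning only if the
  integrand is integrable: for \<open>\<phi> > 2\<close> the Mittag-Leffler factors grow exponentially at the
  endpoints and the integrals diverge.
\<close>

definition gen_beta ::
  "real \<Rightarrow> real \<Rightarrow> complex^'k^'k \<Rightarrow> complex^'k^'k \<Rightarrow> real \<Rightarrow> real \<Rightarrow>
   complex^'k^'k \<Rightarrow> complex^'k^'k \<Rightarrow> complex^'k^'k" where
  "gen_beta \<phi> \<psi> R S \<eta> \<xi> P Q = integral {0<..<1} (beta_integrand \<phi> \<psi> R S \<eta> \<xi> P Q)"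

definition gen_beta_log ::
  "real \<Rightarrow> real \<Rightarrow> complex^'k^'k \<Rightarrow> complex^'k^'k \<Rightarrow> real \<Rightarrow> real \<Rightarrow>
   real \<Rightarrow> real \<Rightarrow> complex^'k^'k \<Rightarrow> complex^'k^'k \<Rightarrow> complex^'k^'k" where
  "gen_beta_log \<phi> \<psi> R S \<eta> \<xi> a b P Q =
     integral {0<..<1} (beta_log_integrand \<phi> \<psi> R S \<eta> \<xi> a b P Q)"

end

theory Submission
  imports Defs
begin

text \<open>
  The integrals may converge only conditionally, so dominated convergence is not available. Instead,
  for a gauge integrable \<open>f\<close> the second mean value theorem bounds \<open>\<integral> h f\<close> by a constant times any
  common bound \<open>B\<close> for \<open>\<bar>h\<bar>\<close> and the Lipschitz constant of \<open>h\<close>. Hence \<open>\<integral> (\<Sum> g\<^sub>i) f = \<Sum> \<integral> g\<^sub>i f\<close>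
  whenever the constants \<open>B\<^sub>i\<close> of the \<open>g\<^sub>i\<close> are summable. This applies to the double exponential
  series of \<open>a powr (1 - x) * b powr x\<close> in \<open>x\<close> and \<open>1 - x\<close>; the same result with \<open>- ln a\<close> and \<open>- ln b\<close>
  removes the weight and gives integrability of the beta integrand itself.
\<close>

section \<open>Lipschitz multipliers of gauge integrable functions\<close>

text \<open>For monotone \<open>g\<close> the second mean value theorem writes the integral of
  \<open>g * f\<close> through \<open>g a\<close>, \<open>g b\<close> and two partial integrals of
  \<open>f\<close>. A Lipschitz \<open>h\<close> is the difference of two monotone functions, so it
  inherits such a bound. \<open>C\<close> is chosen before \<open>h\<close> and \<open>B\<close> and
  depends on \<open>f\<close> and the interval only; this uniformity is what lets the estimate be
  applied to the tails of a series.\<close>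

lemma lipschitz_mult_integral_bound_real:
  fixes f :: "real \<Rightarrow> real"
  assumes f: "f integrable_on {a..b}" and ab: "a \<le> b"
  shows "\<exists>C\<ge>0. \<forall>h B. (\<forall>x\<in>{a..b}. \<bar>h x\<bar> \<le> B) \<and> B-lipschitz_on {a..b} h \<longrightarrow>
           (\<lambda>x. h x * f x) integrable_on {a..b} \<and> \<bar>integral {a..b} (\<lambda>x. h x * f x)\<bar> \<le> C * B"
proof -
  \<comment> \<open>The intermediate point \<open>c\<close> of the mean value theorem is unknown, so
    the partial integrals are bounded uniformly in it. They are continuous in \<open>c\<close> on a
    compact interval.\<close>
  have "bounded ((\<lambda>c. integral {a..c} f) ` {a..b})" "bounded ((\<lambda>c. integral {c..b} f) ` {a..b})"
    using f by (auto intro!: compact_imp_bounded compact_continuous_image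
        indefinite_integral_continuous_1 indefinite_integral_continuous_1')
  then obtain M1 M2 where M1: "\<forall>c\<in>{a..b}. \<bar>integral {a..c} f\<bar> \<le> M1"
    and M2: "\<forall>c\<in>{a..b}. \<bar>integral {c..b} f\<bar> \<le> M2"
    by (auto simp: bounded_iff)
  have M: "M1 \<ge> 0" "M2 \<ge> 0"
    using M1 M2 ab by (meson abs_ge_zero atLeastAtMost_iff order_refl order_trans)+
  \<comment> \<open>The first summand pays for \<open>h\<close> plus a multiple of the identity,
    with one \<open>M1 + M2\<close> to spare; the second pays for that multiple.\<close>
  let ?C = "(1 + (1 + (b - a))) * (M1 + M2) + (b - a) * (M1 + M2)"
  have mono: "(\<lambda>x. g x * f x) integrable_on {a..b} \<and>
      \<bar>integral {a..b} (\<lambda>x. g x * f x)\<bar> \<le> L * (M1 + M2)"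
    if g: "\<And>x y. a \<le> x \<Longrightarrow> x \<le> y \<Longrightarrow> y \<le> b \<Longrightarrow> g x \<le> g y"
      and L: "\<bar>g a\<bar> \<le> L" "\<bar>g b\<bar> \<le> L" for g :: "real \<Rightarrow> real" and L
  proof -
    obtain c where c: "c \<in> {a..b}"
      and I: "((\<lambda>x. g x * f x) has_integral (g a * integral {a..c} f + g b * integral {c..b} f)) {a..b}"
      using second_mean_value_theorem_full[where g = g, OF f ab g] by blast
    have "\<bar>g a * integral {a..c} f + g b * integral {c..b} f\<bar>
        \<le> \<bar>g a\<bar> * \<bar>integral {a..c} f\<bar> + \<bar>g b\<bar> * \<bar>integral {c..b} f\<bar>"
      by (metis abs_mult abs_triangle_ineq)
    also have "\<dots> \<le> L * M1 + L * M2"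
      using L M1 M2 c M by (intro add_mono mult_mono) auto
    finally show ?thesis
      using I by (auto simp: has_integral_iff distrib_left)
  qed
  have "(\<lambda>x. h x * f x) integrable_on {a..b} \<and> \<bar>integral {a..b} (\<lambda>x. h x * f x)\<bar> \<le> ?C * B"
    if h: "\<forall>x\<in>{a..b}. \<bar>h x\<bar> \<le> B" and lip: "B-lipschitz_on {a..b} h" for h B
  proof -
    have B: "0 \<le> B"
      using lip by (rule lipschitz_on_nonneg)
    then have Bab: "0 \<le> B * (b - a)"
      using ab by simp
    \<comment> \<open>Adding a multiple of the identity makes a Lipschitz function monotone.\<close>
    define g where "g x = h x + B * (x - a)" for x
    define k where "k x = B * (x - a)" for x
    have "g x \<le> g y" if "a \<le> x" "x \<le> y" "y \<le> b" for x y
      using lipschitz_onD[OF lip, of x y] that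
      by (auto simp: g_def dist_real_def algebra_simps abs_if split: if_splits)
    moreover have "\<bar>g a\<bar> \<le> B * (1 + (b - a))"
    proof -
      have "\<bar>h a\<bar> \<le> B"
        using h ab by auto
      then show ?thesis
        using Bab unfolding g_def distrib_left by simp
    qed
    moreover have "\<bar>g b\<bar> \<le> B * (1 + (b - a))"
    proof -
      have "\<bar>h b\<bar> \<le> B"
        using h ab by auto
      then show ?thesis
        using Bab unfolding g_def distrib_left by linarith
    qed
    ultimately have g: "(\<lambda>x. g x * f x) integrable_on {a..b}"
        "\<bar>integral {a..b} (\<lambda>x. g x * f x)\<bar> \<le> B * (1 + (b - a)) * (M1 + M2)"
      using mono[of g] by blast+
    have k: "(\<lambda>x. k x * f x) integrable_on {a..b}"
        "\<bar>integral {a..b} (\<lambda>x. k x * f x)\<bar> \<le> B * (b - a) * (M1 + M2)"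
      using mono[of k "B * (b - a)"] B ab by (auto simp: k_def mult_left_mono)
    have eq: "(\<lambda>x. h x * f x) = (\<lambda>x. g x * f x - k x * f x)"
      by (auto simp: g_def k_def algebra_simps)
    have "\<bar>integral {a..b} (\<lambda>x. h x * f x)\<bar>
        \<le> B * (1 + (b - a)) * (M1 + M2) + B * (b - a) * (M1 + M2)"
      unfolding eq integral_diff[OF g(1) k(1)] using g(2) k(2) by linarith
    also have "\<dots> \<le> ?C * B"
      using B M by (simp add: algebra_simps)
    finally show ?thesis
      using integrable_diff[OF g(1) k(1)] eq by simp
  qed
  moreover have "0 \<le> ?C"
    using M ab by simp
  ultimately show ?thesis
    by blast
qed

text \<open>Each coordinate of \<open>f\<close> has its own constant from the real case. Their sum
  works for \<open>f\<close>, because the norm is at most the sum of the absolute values of the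
  coordinates.\<close>

lemma lipschitz_scaleR_integral_bound:
  fixes f :: "real \<Rightarrow> 'v::euclidean_space"
  assumes f: "f integrable_on {a..b}" and ab: "a \<le> b"
  shows "\<exists>C\<ge>0. \<forall>h B. (\<forall>x\<in>{a..b}. \<bar>h x\<bar> \<le> B) \<and> B-lipschitz_on {a..b} h \<longrightarrow>
           (\<lambda>x. h x *\<^sub>R f x) integrable_on {a..b} \<and>
           norm (integral {a..b} (\<lambda>x. h x *\<^sub>R f x)) \<le> C * B"
proof -
  have "\<forall>v\<in>Basis. \<exists>C\<ge>0. \<forall>h B. (\<forall>x\<in>{a..b}. \<bar>h x\<bar> \<le> B) \<and> B-lipschitz_on {a..b} h \<longrightarrow>
      (\<lambda>x. h x * (f x \<bullet> v)) integrable_on {a..b} \<and>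
      \<bar>integral {a..b} (\<lambda>x. h x * (f x \<bullet> v))\<bar> \<le> C * B"
    using integrable_component[OF f] ab by (auto intro!: lipschitz_mult_integral_bound_real)
  from bchoice[OF this] obtain C where C: "\<forall>v\<in>Basis. 0 \<le> C v \<and>
      (\<forall>h B. (\<forall>x\<in>{a..b}. \<bar>h x\<bar> \<le> B) \<and> B-lipschitz_on {a..b} h \<longrightarrow>
        (\<lambda>x. h x * (f x \<bullet> v)) integrable_on {a..b} \<and>
        \<bar>integral {a..b} (\<lambda>x. h x * (f x \<bullet> v))\<bar> \<le> C v * B)"
    by blast
  have "(\<lambda>x. h x *\<^sub>R f x) integrable_on {a..b} \<and>
      norm (integral {a..b} (\<lambda>x. h x *\<^sub>R f x)) \<le> (\<Sum>v\<in>Basis. C v) * B"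
    if h: "\<forall>x\<in>{a..b}. \<bar>h x\<bar> \<le> B" "B-lipschitz_on {a..b} h" for h B
  proof -
    have Ch: "(\<lambda>x. h x * (f x \<bullet> v)) integrable_on {a..b}"
        "\<bar>integral {a..b} (\<lambda>x. h x * (f x \<bullet> v))\<bar> \<le> C v * B" if "v \<in> Basis" for v
      using C that h by blast+
    have I: "(\<lambda>x. h x *\<^sub>R f x) integrable_on {a..b}"
      using Ch(1) by (subst integrable_componentwise_iff) simp
    have "norm (integral {a..b} (\<lambda>x. h x *\<^sub>R f x))
        \<le> (\<Sum>v\<in>Basis. \<bar>integral {a..b} (\<lambda>x. h x *\<^sub>R f x) \<bullet> v\<bar>)"
      by (rule norm_le_l1)
    also have "\<dots> \<le> (\<Sum>v\<in>Basis. C v * B)"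
      using Ch(2) by (intro sum_mono) (simp add: integral_component_eq[OF I, symmetric])
    finally show ?thesis
      using I by (simp add: sum_distrib_right)
  qed
  moreover have "0 \<le> (\<Sum>v\<in>Basis. C v)"
    using C by (intro sum_nonneg) blast
  ultimately show ?thesis
    by blast
qed

text \<open>After removal of a finite \<open>F\<close>, the remainder of \<open>h\<close> is bounded
  by the tail of \<open>B\<close> over \<open>I - F\<close> and has that tail as a Lipschitz
  constant, since both inequalities can be summed termwise. Its integral against \<open>f\<close> is
  then at most \<open>C\<close> times the tail, which tends to 0.\<close>

lemma lipschitz_has_sum_integral:
  fixes f :: "real \<Rightarrow> 'v::euclidean_space" and g :: "'i \<Rightarrow> real \<Rightarrow> real"
  assumes f: "f integrable_on {a..b}" and ab: "a \<le> b"
    and B: "B summable_on I"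
    and g_bound: "\<And>i x. i \<in> I \<Longrightarrow> x \<in> {a..b} \<Longrightarrow> \<bar>g i x\<bar> \<le> B i"
    and g_lip: "\<And>i. i \<in> I \<Longrightarrow> (B i)-lipschitz_on {a..b} (g i)"
    and h: "\<And>x. x \<in> {a..b} \<Longrightarrow> ((\<lambda>i. g i x) has_sum h x) I"
  shows "\<And>i. i \<in> I \<Longrightarrow> (\<lambda>x. g i x *\<^sub>R f x) integrable_on {a..b}"
    and "(\<lambda>x. h x *\<^sub>R f x) integrable_on {a..b}"
    and "((\<lambda>i. integral {a..b} (\<lambda>x. g i x *\<^sub>R f x)) has_sum
           integral {a..b} (\<lambda>x. h x *\<^sub>R f x)) I"
proof -
  obtain C where C0: "C \<ge> 0"
    and C: "\<And>h B. \<forall>x\<in>{a..b}. \<bar>h x\<bar> \<le> B \<Longrightarrow> B-lipschitz_on {a..b} h \<Longrightarrow>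
           (\<lambda>x. h x *\<^sub>R f x) integrable_on {a..b} \<and>
           norm (integral {a..b} (\<lambda>x. h x *\<^sub>R f x)) \<le> C * B"
    using lipschitz_scaleR_integral_bound[OF f ab] by blast
  show gi: "(\<lambda>x. g i x *\<^sub>R f x) integrable_on {a..b}" if "i \<in> I" for i
    using C[of "g i" "B i"] g_bound[OF that] g_lip[OF that] by blast
  have rem_sum: "((\<lambda>i. g i x) has_sum (h x - (\<Sum>i\<in>F. g i x))) (I - F)"
    if "x \<in> {a..b}" "finite F" "F \<subseteq> I" for x F
    using that by (intro has_sum_Diff[OF h]) auto
  have rem: "(\<lambda>x. (h x - (\<Sum>i\<in>F. g i x)) *\<^sub>R f x) integrable_on {a..b} \<and>
      norm (integral {a..b} (\<lambda>x. (h x - (\<Sum>i\<in>F. g i x)) *\<^sub>R f x))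
        \<le> C * (infsum B I - sum B F)"
    if F: "finite F" "F \<subseteq> I" for F
  proof (rule C)
    have BF: "(B has_sum (infsum B I - sum B F)) (I - F)"
      using F B by (intro has_sum_Diff) (auto simp: has_sum_infsum)
    show "\<forall>x\<in>{a..b}. \<bar>h x - (\<Sum>i\<in>F. g i x)\<bar> \<le> infsum B I - sum B F"
      using norm_infsum_le[OF rem_sum[OF _ F] BF] g_bound by auto
    show "(infsum B I - sum B F)-lipschitz_on {a..b} (\<lambda>x. h x - (\<Sum>i\<in>F. g i x))"
    proof (rule lipschitz_onI)
      fix x y assume xy: "x \<in> {a..b}" "y \<in> {a..b}"
      show "dist (h x - (\<Sum>i\<in>F. g i x)) (h y - (\<Sum>i\<in>F. g i y))
          \<le> (infsum B I - sum B F) * dist x y"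
        unfolding dist_norm[of "h x - _"]
      proof (rule norm_infsum_le)
        show "((\<lambda>i. g i x - g i y) has_sum
            (h x - (\<Sum>i\<in>F. g i x) - (h y - (\<Sum>i\<in>F. g i y)))) (I - F)"
          using has_sum_add[OF rem_sum[OF xy(1) F] has_sum_uminusI[OF rem_sum[OF xy(2) F]]]
          by (simp add: algebra_simps)
        show "((\<lambda>i. B i * dist x y) has_sum (infsum B I - sum B F) * dist x y) (I - F)"
          by (rule has_sum_cmult_left[OF BF])
        show "norm (g i x - g i y) \<le> B i * dist x y" if "i \<in> I - F" for i
          using lipschitz_onD[OF g_lip xy] that by (simp add: dist_norm)
      qed
    next
      show "0 \<le> infsum B I - sum B F"
        by (rule has_sum_nonneg[OF BF]) (use g_lip lipschitz_on_nonneg in blast)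
    qed
  qed
  \<comment> \<open>The empty \<open>F\<close> leaves \<open>h\<close> itself as the
    remainder.\<close>
  show hf: "(\<lambda>x. h x *\<^sub>R f x) integrable_on {a..b}"
    using rem[of "{}"] by simp
  have diff: "integral {a..b} (\<lambda>x. (h x - (\<Sum>i\<in>F. g i x)) *\<^sub>R f x) =
      integral {a..b} (\<lambda>x. h x *\<^sub>R f x) - (\<Sum>i\<in>F. integral {a..b} (\<lambda>x. g i x *\<^sub>R f x))"
    if F: "finite F" "F \<subseteq> I" for F
  proof -
    have gF: "\<And>i. i \<in> F \<Longrightarrow> (\<lambda>x. g i x *\<^sub>R f x) integrable_on {a..b}"
      using gi F by blast
    have "integral {a..b} (\<lambda>x. (h x - (\<Sum>i\<in>F. g i x)) *\<^sub>R f x) =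
        integral {a..b} (\<lambda>x. h x *\<^sub>R f x - (\<Sum>i\<in>F. g i x *\<^sub>R f x))"
      by (simp add: scaleR_left_diff_distrib scaleR_sum_left)
    also have "\<dots> = integral {a..b} (\<lambda>x. h x *\<^sub>R f x) - (\<Sum>i\<in>F. integral {a..b} (\<lambda>x. g i x *\<^sub>R f x))"
      by (simp add: integral_diff[OF hf] integral_sum integrable_sum gF F)
    finally show ?thesis .
  qed
  show "((\<lambda>i. integral {a..b} (\<lambda>x. g i x *\<^sub>R f x)) has_sum
      integral {a..b} (\<lambda>x. h x *\<^sub>R f x)) I"
    unfolding has_sum_def
  proof (rule tendsto_dist_iff[THEN iffD2])
    have "((\<lambda>F. C * (infsum B I - sum B F)) \<longlongrightarrow> C * (infsum B I - infsum B I))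
        (finite_subsets_at_top I)"
      using has_sum_infsum[OF B] unfolding has_sum_def by (intro tendsto_intros)
    then have lim: "((\<lambda>F. C * (infsum B I - sum B F)) \<longlongrightarrow> 0) (finite_subsets_at_top I)"
      by simp
    show "((\<lambda>F. dist (\<Sum>i\<in>F. integral {a..b} (\<lambda>x. g i x *\<^sub>R f x))
        (integral {a..b} (\<lambda>x. h x *\<^sub>R f x))) \<longlongrightarrow> 0) (finite_subsets_at_top I)"
    proof (rule tendsto_sandwich[OF _ _ tendsto_const lim])
      show "\<forall>\<^sub>F F in finite_subsets_at_top I.
          dist (\<Sum>i\<in>F. integral {a..b} (\<lambda>x. g i x *\<^sub>R f x)) (integral {a..b} (\<lambda>x. h x *\<^sub>R f x))
            \<le> C * (infsum B I - sum B F)"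
        using rem diff
        by (intro eventually_finite_subsets_at_top_weakI) (simp add: dist_norm norm_minus_commute)
    qed simp
  qed
qed

section \<open>Expansion of the exponential weight\<close>

lemma exp_mult_exp_has_sum:
  fixes s t :: real
  shows "((\<lambda>(n, r). s ^ n / fact n * (t ^ r / fact r)) has_sum (exp s * exp t)) UNIV"
proof -
  have E: "((\<lambda>n. s ^ n / fact n) has_sum exp s) UNIV" for s :: real
    using exp_converges[of s] summable_norm_exp[of s]
    by (intro norm_summable_imp_has_sum) (simp_all add: field_simps)
  \<comment> \<open>With absolute values all terms are nonnegative, so summable row sums already
    give summability over pairs; the signed family then follows by absolute summability.\<close>
  have "(\<lambda>(n, r). \<bar>s\<bar> ^ n / fact n * (\<bar>t\<bar> ^ r / fact r)) summable_on (UNIV \<times> UNIV)"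
    using has_sum_cmult_right[OF E] has_sum_imp_summable[OF has_sum_cmult_left[OF E]]
    by (intro summable_on_SigmaI[where g = "\<lambda>n. \<bar>s\<bar> ^ n / fact n * exp \<bar>t\<bar>"])
      (simp_all only: case_prod_conv, simp)
  then have "(\<lambda>p. norm (case p of (n, r) \<Rightarrow> s ^ n / fact n * (t ^ r / fact r)))
      summable_on (UNIV \<times> UNIV)"
    by (simp add: case_prod_unfold abs_mult power_abs)
  then have "(\<lambda>(n, r). s ^ n / fact n * (t ^ r / fact r)) summable_on (UNIV \<times> UNIV)"
    by (rule abs_summable_summable)
  then show ?thesis
    unfolding UNIV_Times_UNIV[symmetric]
    using has_sum_cmult_right[OF E] has_sum_cmult_left[OF E]
    by (intro has_sum_SigmaI[where g = "\<lambda>n. s ^ n / fact n * exp t"])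
      (simp_all only: case_prod_conv)
qed

text \<open>For \<alpha> = \<open>ln a\<close> and \<beta> = \<open>ln b\<close> the weight is
  \<open>a powr (1 - x) * b powr x\<close>. Its double exponential series is integrated term by term
  against \<open>f\<close>.\<close>

lemma exp_weight_has_sum_integral:
  fixes f :: "real \<Rightarrow> 'v::euclidean_space" and \<alpha> \<beta> :: real
  assumes f: "f integrable_on {0..1}"
  shows "(\<lambda>x. (exp (\<beta> * x) * exp (\<alpha> * (1 - x))) *\<^sub>R f x) integrable_on {0..1}"
    and "(\<lambda>x. (x ^ n * (1 - x) ^ r) *\<^sub>R f x) integrable_on {0..1}"
    and "((\<lambda>(n, r). (\<beta> ^ n / fact n * (\<alpha> ^ r / fact r)) *\<^sub>R
             integral {0..1} (\<lambda>x. (x ^ n * (1 - x) ^ r) *\<^sub>R f x)) has_sum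
           integral {0..1} (\<lambda>x. (exp (\<beta> * x) * exp (\<alpha> * (1 - x))) *\<^sub>R f x)) UNIV"
proof -
  \<comment> \<open>\<alpha> and \<beta> are quantified afresh because the integrability of a
    monomial times \<open>f\<close> is read off at the value 1 for both: there no coefficient of the
    series vanishes.\<close>
  have main: "(\<lambda>x. (exp (\<beta> * x) * exp (\<alpha> * (1 - x))) *\<^sub>R f x) integrable_on {0..1} \<and>
      (\<lambda>x. (\<beta> ^ n / fact n * (\<alpha> ^ r / fact r) * (x ^ n * (1 - x) ^ r)) *\<^sub>R f x)
        integrable_on {0..1} \<and>
      ((\<lambda>(n, r). (\<beta> ^ n / fact n * (\<alpha> ^ r / fact r)) *\<^sub>R
             integral {0..1} (\<lambda>x. (x ^ n * (1 - x) ^ r) *\<^sub>R f x)) has_sum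
           integral {0..1} (\<lambda>x. (exp (\<beta> * x) * exp (\<alpha> * (1 - x))) *\<^sub>R f x)) UNIV"
    for \<alpha> \<beta> n r
  proof -
    define c where "c = (\<lambda>(n, r). \<beta> ^ n / fact n * (\<alpha> ^ r / fact r) :: real)"
    define g where "g = (\<lambda>(n, r) x. c (n, r) * (x ^ n * (1 - x) ^ r) :: real)"
    \<comment> \<open>The Lipschitz constant of \<open>x ^ n * (1 - x) ^ r\<close> is at most \<open>n + r \<le> 2 ^ n * 2 ^ r\<close>.\<close>
    define B where "B = (\<lambda>(n, r). (2 * \<bar>\<beta>\<bar>) ^ n / fact n * ((2 * \<bar>\<alpha>\<bar>) ^ r / fact r) :: real)"
    have B_eq: "B (n, r) = \<bar>c (n, r)\<bar> * (2 ^ n * 2 ^ r)" for n r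
      by (simp add: B_def c_def abs_mult power_mult_distrib power_abs)
    \<comment> \<open>The generous factor \<open>2 ^ n * 2 ^ r\<close> keeps \<open>B\<close> a
      double exponential series, now at twice the absolute values of \<beta> and \<alpha>.\<close>
    have 1: "B summable_on UNIV"
      using exp_mult_exp_has_sum[of "2 * \<bar>\<beta>\<bar>" "2 * \<bar>\<alpha>\<bar>"] by (auto simp: B_def summable_on_def)
    have 2: "\<bar>g i x\<bar> \<le> B i" if x: "x \<in> {0..1}" for i x
    proof (cases i)
      case (Pair n r)
      have "\<bar>x\<bar> ^ n * \<bar>1 - x\<bar> ^ r \<le> 2 ^ n * 2 ^ r"
        using x by (intro mult_mono power_mono) auto
      then show ?thesis
        unfolding Pair B_eq by (simp add: g_def abs_mult power_abs mult_left_mono)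
    qed
    have 3: "(B i)-lipschitz_on {0..1} (g i)" for i
    proof (cases i)
      case (Pair n r)
      show ?thesis
      proof (rule lipschitz_onI)
        fix x y :: real assume xy: "x \<in> {0..1}" "y \<in> {0..1}"
        \<comment> \<open>Discrete product rule: on the unit interval the powers are at most 1, and
          an \<open>n\<close>-th power has Lipschitz constant \<open>n\<close>.\<close>
        have "\<bar>x ^ n * (1 - x) ^ r - y ^ n * (1 - y) ^ r\<bar>
            = \<bar>x ^ n * ((1 - x) ^ r - (1 - y) ^ r) + (x ^ n - y ^ n) * (1 - y) ^ r\<bar>"
          by (simp add: algebra_simps)
        also have "\<dots> \<le> \<bar>x ^ n\<bar> * \<bar>(1 - x) ^ r - (1 - y) ^ r\<bar> + \<bar>x ^ n - y ^ n\<bar> * \<bar>(1 - y) ^ r\<bar>"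
          by (metis abs_mult abs_triangle_ineq)
        also have "\<dots> \<le> 1 * (real r * \<bar>x - y\<bar>) + (real n * \<bar>x - y\<bar>) * 1"
        proof (intro add_mono mult_mono)
          show "\<bar>(1 - x) ^ r - (1 - y) ^ r\<bar> \<le> real r * \<bar>x - y\<bar>"
            using norm_power_diff[of "1 - x" "1 - y" r] xy by (simp add: abs_minus_commute)
          show "\<bar>x ^ n - y ^ n\<bar> \<le> real n * \<bar>x - y\<bar>"
            using norm_power_diff[of x y n] xy by simp
        qed (use xy in \<open>auto simp: power_abs intro!: power_le_one\<close>)
        also have "\<dots> = real (n + r) * \<bar>x - y\<bar>"
          by (simp add: algebra_simps)
        also have "\<dots> \<le> 2 ^ (n + r) * \<bar>x - y\<bar>"
          by (intro mult_right_mono less_imp_le[OF of_nat_less_two_power]) simp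
        finally have "\<bar>c (n, r)\<bar> * \<bar>x ^ n * (1 - x) ^ r - y ^ n * (1 - y) ^ r\<bar>
            \<le> \<bar>c (n, r)\<bar> * (2 ^ (n + r) * \<bar>x - y\<bar>)"
          by (rule mult_left_mono) simp
        then show "dist (g i x) (g i y) \<le> B i * dist x y"
          unfolding Pair B_eq dist_real_def
          by (simp add: g_def abs_mult[symmetric] right_diff_distrib[symmetric] power_add mult.assoc)
      qed (simp add: Pair B_eq)
    qed
    have 4: "((\<lambda>i. g i x) has_sum (exp (\<beta> * x) * exp (\<alpha> * (1 - x)))) UNIV" for x
      using exp_mult_exp_has_sum[of "\<beta> * x" "\<alpha> * (1 - x)"]
      by (simp add: g_def c_def case_prod_unfold power_mult_distrib mult_ac)
    note L = lipschitz_has_sum_integral[OF f, of B UNIV g, OF _ 1 2 3 4]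
    have "integral {0..1} (\<lambda>x. g i x *\<^sub>R f x) =
        (case i of (n, r) \<Rightarrow> (\<beta> ^ n / fact n * (\<alpha> ^ r / fact r)) *\<^sub>R
             integral {0..1} (\<lambda>x. (x ^ n * (1 - x) ^ r) *\<^sub>R f x))" for i
      by (cases i) (simp only: g_def c_def case_prod_conv scaleR_scaleR[symmetric] integral_cmul)
    with L(1)[of "(n, r)"] L(2) L(3) show ?thesis
      by (simp add: g_def c_def)
  qed
  show "(\<lambda>x. (exp (\<beta> * x) * exp (\<alpha> * (1 - x))) *\<^sub>R f x) integrable_on {0..1}"
    and "((\<lambda>(n, r). (\<beta> ^ n / fact n * (\<alpha> ^ r / fact r)) *\<^sub>R
             integral {0..1} (\<lambda>x. (x ^ n * (1 - x) ^ r) *\<^sub>R f x)) has_sum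
           integral {0..1} (\<lambda>x. (exp (\<beta> * x) * exp (\<alpha> * (1 - x))) *\<^sub>R f x)) UNIV"
    using main by blast+
  \<comment> \<open>The coefficient at parameters 1 is the reciprocal of
    \<open>fact n * fact r\<close>, which is multiplied away.\<close>
  have "(\<lambda>x. (fact n * fact r) *\<^sub>R ((1 / fact n * (1 / fact r) * (x ^ n * (1 - x) ^ r)) *\<^sub>R f x))
      integrable_on {0..1}"
    using main[of 1 1 n r] by (intro integrable_cmul) simp
  then show "(\<lambda>x. (x ^ n * (1 - x) ^ r) *\<^sub>R f x) integrable_on {0..1}"
    by (simp add: field_simps)
qed

section \<open>The matrix exponential under scalar shifts\<close>

lemma matrix_mult_add_left: "(A + B) ** C = A ** C + B ** C"
  for A B :: "complex^'n^'m" and C :: "complex^'p^'n"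
  by (simp add: matrix_matrix_mult_def vec_eq_iff sum.distrib distrib_right)

lemma matrix_mult_scaleR_left: "(c *\<^sub>R A) ** B = c *\<^sub>R (A ** B)"
  for A :: "complex^'n^'m" and B :: "complex^'p^'n"
  by (simp add: matrix_matrix_mult_def vec_eq_iff scaleR_sum_right)

lemma matrix_mult_scaleR_right: "A ** (c *\<^sub>R B) = c *\<^sub>R (A ** B)"
  for A :: "complex^'n^'m" and B :: "complex^'p^'n"
  by (simp add: matrix_matrix_mult_def vec_eq_iff scaleR_sum_right)

text \<open>Each further factor \<open>A\<close> produces a sum of \<open>CARD('k)\<close> terms and
  contributes at most \<open>norm A\<close> to each. The geometric bound allows comparison with a
  scalar exponential series.\<close>

lemma mat_pow_entry_bound:
  fixes A :: "complex^'k^'k"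
  shows "norm (mat_pow A n $ i $ j) \<le> (real CARD('k) * norm A) ^ n"
proof (induction n arbitrary: i j)
  case 0
  then show ?case
    by (simp add: mat_def)
next
  case (Suc n)
  have A: "norm (A $ i $ l) \<le> norm A" for l
    by (meson Finite_Cartesian_Product.norm_nth_le order_trans)
  have "norm (mat_pow A (Suc n) $ i $ j) \<le> (\<Sum>l\<in>UNIV. norm (A $ i $ l * mat_pow A n $ l $ j))"
    by (simp add: matrix_matrix_mult_def norm_sum)
  also have "\<dots> \<le> (\<Sum>l\<in>(UNIV :: 'k set). norm A * (real CARD('k) * norm A) ^ n)"
    unfolding norm_mult using A Suc by (intro sum_mono mult_mono) auto
  finally show ?case
    by simp
qed

lemma summable_norm_mat_exp_entry:
  "summable (\<lambda>n. norm (((1 / fact n) *\<^sub>R mat_pow A n) $ i $ j))"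
  for A :: "complex^'k^'k"
proof (rule summable_comparison_test')
  show "summable (\<lambda>n. (real CARD('k) * norm A) ^ n / fact n)"
    using summable_exp[of "real CARD('k) * norm A"] by (simp add: field_simps)
  show "norm (norm (((1 / fact n) *\<^sub>R mat_pow A n) $ i $ j)) \<le> (real CARD('k) * norm A) ^ n / fact n"
    if "n \<ge> 0" for n
    using mat_pow_entry_bound[of A n i j] by (simp add: divide_right_mono)
qed

lemma sums_mat_entrywise:
  fixes f :: "nat \<Rightarrow> complex^'k^'k"
  assumes "\<And>i j. (\<lambda>n. f n $ i $ j) sums (S $ i $ j)"
  shows "f sums S"
  unfolding sums_def
proof (intro vec_tendstoI)
  show "(\<lambda>n. (\<Sum>l<n. f l) $ i $ j) \<longlonglongrightarrow> S $ i $ j" for i j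
    using assms[of i j] by (simp add: sums_def)
qed

text \<open>\<open>mat_exp\<close> is a \<open>suminf\<close>, which says nothing before convergence
  is known. Entrywise convergence settles this and reduces later work to complex series.\<close>

lemma mat_exp_entry_sums:
  "(\<lambda>n. ((1 / fact n) *\<^sub>R mat_pow A n) $ i $ j) sums (mat_exp A $ i $ j)"
  for A :: "complex^'k^'k"
proof -
  note entry = summable_sums[OF summable_norm_cancel[OF summable_norm_mat_exp_entry]]
  have "(\<lambda>n. (1 / fact n) *\<^sub>R mat_pow A n) sums
      (\<chi> i j. \<Sum>n. ((1 / fact n) *\<^sub>R mat_pow A n) $ i $ j)"
    using entry by (intro sums_mat_entrywise) (simp only: vec_lambda_beta)
  then have "mat_exp A = (\<chi> i j. \<Sum>n. ((1 / fact n) *\<^sub>R mat_pow A n) $ i $ j)"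
    unfolding mat_exp_def by (rule sums_unique[symmetric])
  then show ?thesis
    using entry[of A i j] by (simp only: vec_lambda_beta)
qed

text \<open>The binomial theorem for \<open>A\<close> and a scalar matrix, which commute. The
  induction multiplies from the left, as \<open>mat_pow\<close> does, and ends with Pascal's
  rule.\<close>

lemma mat_pow_add_scalar:
  "mat_pow (A + c *\<^sub>R mat 1) n = (\<Sum>i\<le>n. (real (n choose i) * c ^ (n - i)) *\<^sub>R mat_pow A i)"
proof (induction n)
  case (Suc n)
  have eq: "(A + c *\<^sub>R mat 1) ** X = A ** X + c *\<^sub>R X" for X
    by (simp add: matrix_mult_add_left matrix_mult_scaleR_left)
  have sumA: "A ** (\<Sum>i\<in>F. g i) = (\<Sum>i\<in>F. A ** g i)" for g :: "nat \<Rightarrow> _" and F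
    by (induction F rule: infinite_finite_induct) (simp_all add: matrix_add_ldistrib)
  have "mat_pow (A + c *\<^sub>R mat 1) (Suc n) =
      (\<Sum>i\<le>n. (real (n choose i) * c ^ (n - i)) *\<^sub>R mat_pow A (Suc i)) +
      (\<Sum>i\<le>n. (real (n choose i) * c ^ (Suc n - i)) *\<^sub>R mat_pow A i)"
    by (simp add: Suc eq sumA matrix_mult_scaleR_right scaleR_sum_right Suc_diff_le mult_ac)
  \<comment> \<open>The added term is zero, as \<open>n choose Suc n = 0\<close>; it makes the index
    shift end at \<open>n\<close> again.\<close>
  also have "(\<Sum>i\<le>n. (real (n choose i) * c ^ (Suc n - i)) *\<^sub>R mat_pow A i) =
      (\<Sum>i\<le>Suc n. (real (n choose i) * c ^ (Suc n - i)) *\<^sub>R mat_pow A i)"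
    by simp
  also have "\<dots> = c ^ Suc n *\<^sub>R mat_pow A 0 +
      (\<Sum>i\<le>n. (real (n choose Suc i) * c ^ (n - i)) *\<^sub>R mat_pow A (Suc i))"
    by (subst sum.atMost_Suc_shift) simp
  also have "(\<Sum>i\<le>n. (real (n choose i) * c ^ (n - i)) *\<^sub>R mat_pow A (Suc i)) + \<dots> =
      (\<Sum>i\<le>Suc n. (real (Suc n choose i) * c ^ (Suc n - i)) *\<^sub>R mat_pow A i)"
    unfolding sum.atMost_Suc_shift
    by (simp add: sum.distrib[symmetric] scaleR_left_distrib[symmetric] distrib_right[symmetric] add_ac
        del: mat_pow.simps)
  finally show ?case .
qed simp

text \<open>Cauchy product of an entry series of \<open>mat_exp A\<close> with the scalar series of
  \<open>exp c\<close>; the binomial expansion identifies its terms.\<close>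

lemma mat_exp_add_scalar: "mat_exp (A + c *\<^sub>R mat 1) = exp c *\<^sub>R mat_exp A"
  for A :: "complex^'k^'k"
proof (intro vec_eq_iff[THEN iffD2] allI)
  fix i j
  let ?a = "\<lambda>n. ((1 / fact n) *\<^sub>R mat_pow A n) $ i $ j"
  let ?b = "\<lambda>n. of_real c ^ n /\<^sub>R fact n :: complex"
  have "(\<lambda>n. \<Sum>l\<le>n. ?a l * ?b (n - l)) sums ((\<Sum>n. ?a n) * (\<Sum>n. ?b n))"
    by (intro Cauchy_product_sums summable_norm_mat_exp_entry summable_norm_exp)
  moreover have "(\<Sum>n. ?a n) = mat_exp A $ i $ j"
    using mat_exp_entry_sums by (rule sums_unique[symmetric])
  moreover have "(\<Sum>n. ?b n) = of_real (exp c)"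
    using exp_converges[of "of_real c :: complex"] by (simp add: sums_iff exp_of_real)
  moreover have "(\<Sum>l\<le>n. ?a l * ?b (n - l)) =
      ((1 / fact n) *\<^sub>R mat_pow (A + c *\<^sub>R mat 1) n) $ i $ j" for n
    unfolding mat_pow_add_scalar
    by (simp only: vector_scaleR_component sum_component)
      (simp add: scaleR_conv_of_real sum_distrib_left binomial_fact divide_simps mult_ac)
  ultimately have "(\<lambda>n. ((1 / fact n) *\<^sub>R mat_pow (A + c *\<^sub>R mat 1) n) $ i $ j) sums
      (mat_exp A $ i $ j * of_real (exp c))"
    by simp
  from sums_unique2[OF mat_exp_entry_sums this]
  show "mat_exp (A + c *\<^sub>R mat 1) $ i $ j = (exp c *\<^sub>R mat_exp A) $ i $ j"
    by (simp only: vector_scaleR_component) (simp add: scaleR_conv_of_real mult.commute)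
qed

lemma real_powr_mat_add_nat:
  assumes "x > 0"
  shows "real_powr_mat x (A + real n *\<^sub>R mat 1 - mat 1) = x ^ n *\<^sub>R real_powr_mat x (A - mat 1)"
proof -
  have "ln x *\<^sub>R (A + real n *\<^sub>R mat 1 - mat 1) = ln x *\<^sub>R (A - mat 1) + (real n * ln x) *\<^sub>R mat 1"
    by (simp add: algebra_simps)
  then show ?thesis
    using assms by (simp add: real_powr_mat_def mat_exp_add_scalar exp_of_nat_mult)
qed

section \<open>The beta and beta-logarithmic integrals\<close>

text \<open>Shifting \<open>P\<close> and \<open>Q\<close> by multiples of the identity yields
  scalar factors, which leave the noncommutative product freely. These are exactly the monomials in
  the expansion of the weight. The open interval makes both bases \<open>x\<close> and
  \<open>1 - x\<close> positive.\<close>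

lemma beta_integrand_shift:
  assumes "x \<in> {0<..<1}"
  shows "beta_integrand \<phi> \<psi> R S \<eta> \<xi> (P + real n *\<^sub>R mat 1) (Q + real r *\<^sub>R mat 1) x =
    (x ^ n * (1 - x) ^ r) *\<^sub>R beta_integrand \<phi> \<psi> R S \<eta> \<xi> P Q x"
  using assms
  by (simp add: beta_integrand_def real_powr_mat_add_nat matrix_mult_scaleR_left
      matrix_mult_scaleR_right mult.commute)

text \<open>Existence of the left integral is assumed, because the integrals can diverge; existence
  of every beta integral is concluded, so that no term of the sum is the default value 0 of
  \<open>integral\<close>. \<open>has_sum\<close> over pairs makes the double sum independent of the
  order of summation.\<close>

theorem theorem3p3:
  fixes \<phi> \<psi> \<eta> \<xi> a b :: real
    and P Q R S :: "complex^'k^'k"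
  assumes "\<phi> > 0" "\<psi> > 0" "\<eta> > 0" "\<xi> > 0" "a > 0" "b > 0"
    and "P \<in> hermitian_pos_stable" "Q \<in> hermitian_pos_stable"
    and "R \<in> hermitian_pos_stable" "S \<in> hermitian_pos_stable"
    and lhs_exists: "beta_log_integrand \<phi> \<psi> R S \<eta> \<xi> a b P Q integrable_on {0<..<1}"
  shows "(\<forall>n r :: nat. beta_integrand \<phi> \<psi> R S \<eta> \<xi> (P + real n *\<^sub>R mat 1) (Q + real r *\<^sub>R mat 1)
            integrable_on {0<..<1})
    \<and> ((\<lambda>(n :: nat, r :: nat).
          ((ln a) ^ r * (ln b) ^ n / (fact n * fact r)) *\<^sub>R
            gen_beta \<phi> \<psi> R S \<eta> \<xi> (P + real n *\<^sub>R mat 1) (Q + real r *\<^sub>R mat 1))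
        has_sum gen_beta_log \<phi> \<psi> R S \<eta> \<xi> a b P Q) UNIV"
proof -
  let ?G = "beta_integrand \<phi> \<psi> R S \<eta> \<xi> P Q"
  let ?w = "\<lambda>x. exp (ln b * x) * exp (ln a * (1 - x))"
  have F: "beta_log_integrand \<phi> \<psi> R S \<eta> \<xi> a b P Q = (\<lambda>x. ?w x *\<^sub>R ?G x)"
    using assms by (auto simp: beta_log_integrand_def beta_integrand_def powr_def mult_ac)
  \<comment> \<open>The reciprocal of \<open>?w\<close> has the same exponential form, so
    integrability passes from \<open>?w\<close> times \<open>?G\<close> back to \<open>?G\<close>.
    The change between open and closed interval only affects two points.\<close>
  have "(\<lambda>x. (exp (- ln b * x) * exp (- ln a * (1 - x))) *\<^sub>R (?w x *\<^sub>R ?G x)) integrable_on {0..1}"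
    using lhs_exists unfolding F integrable_on_Icc_iff_Ioo[symmetric]
    by (rule exp_weight_has_sum_integral(1))
  moreover have "(exp (- ln b * x) * exp (- ln a * (1 - x))) * ?w x = 1" for x
    by (simp add: exp_add[symmetric])
  ultimately have G: "?G integrable_on {0..1}"
    by (simp only: scaleR_scaleR scaleR_one)
  note E = exp_weight_has_sum_integral[OF G]
  have "beta_integrand \<phi> \<psi> R S \<eta> \<xi> (P + real n *\<^sub>R mat 1) (Q + real r *\<^sub>R mat 1)
      integrable_on {0<..<1}" for n r
    using E(2)[of n r] unfolding integrable_on_Icc_iff_Ioo
    by (rule integrable_eq) (simp add: beta_integrand_shift)
  moreover have "gen_beta \<phi> \<psi> R S \<eta> \<xi> (P + real n *\<^sub>R mat 1) (Q + real r *\<^sub>R mat 1) =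
      integral {0..1} (\<lambda>x. (x ^ n * (1 - x) ^ r) *\<^sub>R ?G x)" for n r
    unfolding gen_beta_def integral_open_interval_real
    by (rule integral_cong) (rule beta_integrand_shift)
  moreover have "gen_beta_log \<phi> \<psi> R S \<eta> \<xi> a b P Q = integral {0..1} (\<lambda>x. ?w x *\<^sub>R ?G x)"
    by (simp add: gen_beta_log_def F integral_open_interval_real)
  \<comment> \<open>\<open>ln b\<close> goes with \<open>n\<close>, the exponent of
    \<open>x\<close>, and \<open>ln a\<close> with \<open>r\<close>, the exponent of
    \<open>1 - x\<close>.\<close>
  ultimately show ?thesis
    using E(3)[of "ln b" "ln a"] by (simp add: mult.commute)
qed

end
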